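(* Every uncountable locally compact Polish group contains a naively left Haar null set that is not Haar null. In particular, every uncountable locally compact abelian Polish group contains a naively Haar null set that is not Haar null.
   Context: A Polish group is a topological group whose topology is separable and completely metrizable. Let $G$ be a Polish group. Borel measures are identified with their completions; so for a Borel probability measure $\mu$ on $G$ and an arbitrary set $A \subset G$, $\mu(A)=0$ means that $A$ is contained in a Borel set of $\mu$-measure zero. A subset of $G$ is universally measurable if it is measurable with respect to (the completion of) every Borel probability measure on $G$. A set $X \subset G$ is Haar null if there exist a universally measurable set $U \supset X$ and a Borel probability measure $\mu$ on $G$ such that $\mu(gUh)=0$ for every $g,h \in G$. A set $X \subset G$ is naively Haar null if there exists a Borel probability measure $\mu$ on $G$ such that $\mu(gXh)=0$ for every $g,h \in G$. A set $X \subset G$ is naively left Haar null if there exists a Borel probability measure $\mu$ on $G$ such that $\mu(gX)=0$ for every $g \in G$. *)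

theory Defs
  imports "HOL-Probability.Probability"
begin

text \<open>
  Groups are written additively, because \<^class>\<open>topological_group_add\<close> is the library's class of
  topological groups; it does not assume commutativity, so the two-sided translate $gXh$ becomes
  \<open>(\<lambda>x. g + x + h) ` X\<close>. A Polish group is a type of sort
  \<open>{polish_space, topological_group_add}\<close>. The class \<^class>\<open>polish_space\<close> carries some complete
  metric inducing the topology; it is not assumed to be translation invariant, and the notions below
  depend only on the topology and the group operation.
\<close>

definition borel_prob :: "'a::topological_space measure \<Rightarrow> bool" where
  "borel_prob \<mu> \<longleftrightarrow> prob_space \<mu> \<and> sets \<mu> = sets borel"

definition universally_measurable :: "'a::topological_space set \<Rightarrow> bool" where
  "universally_measurable U \<longleftrightarrow> (\<forall>\<mu>. borel_prob \<mu> \<longrightarrow> U \<in> sets (completion \<mu>))"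

text \<open>
  For a measure \<open>\<mu>\<close> on the Borel sets, \<open>A \<in> null_sets (completion \<mu>)\<close> says that the arbitrary set
  \<open>A\<close> is contained in a Borel set of \<open>\<mu>\<close>-measure zero (lemma \<open>null_sets_completion_iff2\<close>).
\<close>

definition haar_null :: "'a::topological_group_add set \<Rightarrow> bool" where
  "haar_null X \<longleftrightarrow> (\<exists>U \<mu>. universally_measurable U \<and> X \<subseteq> U \<and> borel_prob \<mu> \<and>
     (\<forall>g h. (\<lambda>x. g + x + h) ` U \<in> null_sets (completion \<mu>)))"

definition naively_haar_null :: "'a::topological_group_add set \<Rightarrow> bool" where
  "naively_haar_null X \<longleftrightarrow> (\<exists>\<mu>. borel_prob \<mu> \<and>
     (\<forall>g h. (\<lambda>x. g + x + h) ` X \<in> null_sets (completion \<mu>)))"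

definition naively_left_haar_null :: "'a::topological_group_add set \<Rightarrow> bool" where
  "naively_left_haar_null X \<longleftrightarrow> (\<exists>\<mu>. borel_prob \<mu> \<and>
     (\<forall>g. (\<lambda>x. g + x) ` X \<in> null_sets (completion \<mu>)))"

end

theory Submission
  imports Defs
begin

text \<open>
  Write \<open>G\<close> for the group. The proof rests on two perfect sets in \<open>G\<close> that are independent of each
  other: a closed set \<open>K\<close> carrying a continuous probability measure, and an injective Borel curve
  \<open>\<phi>\<close> on \<open>[0, 1)\<close>, such that \<open>- \<phi> s + \<phi> t \<noteq> - a + b - c + d\<close> for all \<open>s \<noteq> t\<close> and all
  \<open>a, b, c, d \<in> K\<close> (lemma \<open>separated_curves\<close>). Put \<open>D = - K + K\<close>. The inequality implies that a left
  translate of \<open>D\<close> contains at most one point of any left translate of the image of \<open>\<phi>\<close>. Hence fewer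
  than continuum many left translates of \<open>D\<close> cannot cover \<open>m + \<phi> ` A\<close> when \<open>A\<close> has the cardinality
  of the continuum, and closed sets \<open>A\<close> of positive Lebesgue measure do.

  There are only continuum many pairs \<open>(m, A)\<close> with \<open>m \<in> G\<close> and \<open>A \<subseteq> [0, 1)\<close> closed of positive
  measure. A transfinite recursion therefore chooses a point of \<open>m + \<phi> ` A\<close> for each of them,
  always outside the translates \<open>y + D\<close> of the points \<open>y\<close> chosen before. Let \<open>X\<close> be the set of
  chosen points (lemma \<open>exists_sparse_transversal\<close>).

  \<^item> \<open>X\<close> is naively left Haar null: if \<open>x, y \<in> X\<close> and \<open>g + x, g + y \<in> K\<close>, then \<open>- x + y \<in> D\<close>, which
    the construction excludes for \<open>x \<noteq> y\<close>. So \<open>(g + X) \<inter> K\<close> has at most one point, and the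
    continuous measure on \<open>K\<close> does not see \<open>g + X\<close>.

  \<^item> \<open>X\<close> is not Haar null: suppose that \<open>\<mu>\<close> vanishes on all two-sided translates of a universally measurable
    \<open>U \<supseteq> X\<close>. By Fubini the convolution of \<open>\<mu>\<close> with the image of Lebesgue measure under \<open>\<phi>\<close> vanishes
    on \<open>U\<close>, hence on a Borel set \<open>B \<supseteq> U\<close>. So for some \<open>m\<close> almost no \<open>t\<close> satisfies
    \<open>m + \<phi> t \<in> B\<close>, and there is a closed \<open>A\<close> of positive measure with \<open>m + \<phi> ` A\<close> disjoint from
    \<open>B \<supseteq> X\<close>. This contradicts the choice of a point of \<open>X\<close> in \<open>m + \<phi> ` A\<close>.

  In an abelian group left translates and two-sided translates coincide, which gives the second claim.
\<close>

section \<open>Two independent perfect sets\<close>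

lemma at_zero_neq_bot_if_uncountable:
  assumes "uncountable (UNIV :: 'a::{second_countable_topology, topological_group_add} set)"
  shows "at (0::'a) \<noteq> bot"
proof
  assume "at (0::'a) = bot"
  then have open0: "open {0::'a}"
    by (simp add: at_eq_bot_iff)
  have op: "open {x::'a}" for x
  proof -
    have "open ((\<lambda>y. - x + y) -` {0})"
      by (intro open_vimage open0 continuous_intros)
    moreover have "(\<lambda>y. - x + y) -` {0} = {x}"
      by (auto simp: add_eq_0_iff)
    ultimately show ?thesis by simp
  qed
  obtain B :: "'a set set" where B: "countable B" "topological_basis B"
    using ex_countable_basis by blast
  \<comment> \<open>a basis of a discrete space contains every singleton\<close>
  have "{x} \<in> B" for x
    using topological_basisE[OF B(2) op, of x x] by (metis insertI1 subset_singletonD empty_iff)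
  then have "range (\<lambda>x::'a. {x}) \<subseteq> B" by blast
  then have "countable (range (\<lambda>x::'a. {x}))"
    using B(1) countable_subset by blast
  then have "countable (UNIV::'a set)"
    by (rule countable_image_inj_on) simp
  with assms show False by blast
qed

lemma dist_Pair_le: "dist (x, y) (x', y') \<le> dist x x' + dist y y'"
  by (simp add: dist_Pair_Pair sqrt_sum_squares_le_sum)

definition double_diff :: "'a::group_add \<Rightarrow> 'a \<Rightarrow> 'a \<Rightarrow> 'a \<Rightarrow> 'a" where
  "double_diff a b c d = - a + b - c + d"

text \<open>
  The left-hand side and the right-hand side depend continuously on all six points, so the
  inequality survives a small perturbation of them.
\<close>

lemma double_diff_stable:
  fixes x y :: "'a::{metric_space, topological_group_add}"
  assumes "- x + y \<noteq> double_diff a b c d"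
  shows "\<forall>\<^sub>F e in at_right 0. \<forall>x'\<in>cball x e. \<forall>y'\<in>cball y e.
    \<forall>a'\<in>cball a e. \<forall>b'\<in>cball b e. \<forall>c'\<in>cball c e. \<forall>d'\<in>cball d e. - x' + y' \<noteq> double_diff a' b' c' d'"
proof -
  define W where "W = {p :: 'a \<times> 'a \<times> 'a \<times> 'a \<times> 'a \<times> 'a. case p of (x, y, a, b, c, d) \<Rightarrow>
      - x + y \<noteq> - a + b - c + d}"
  have "open W"
    unfolding W_def case_prod_beta diff_conv_add_uminus
    by (intro open_Collect_neq continuous_intros)
  moreover have "(x, y, a, b, c, d) \<in> W"
    using assms by (simp add: W_def double_diff_def)
  ultimately obtain r where r: "r > 0" "\<And>p. dist p (x, y, a, b, c, d) < r \<Longrightarrow> p \<in> W"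
    by (meson open_dist)
  have "- x' + y' \<noteq> double_diff a' b' c' d'"
    if e: "e < r / 6" and close: "x' \<in> cball x e" "y' \<in> cball y e" "a' \<in> cball a e" "b' \<in> cball b e"
      "c' \<in> cball c e" "d' \<in> cball d e" for e x' y' a' b' c' d'
  proof -
    have "dist (x', y', a', b', c', d') (x, y, a, b, c, d)
        \<le> dist x' x + (dist y' y + (dist a' a + (dist b' b + (dist c' c + dist d' d))))"
      by (intro order_trans[OF dist_Pair_le] add_left_mono order_refl)
    also have "\<dots> < r"
      using e close by (simp add: dist_commute)
    finally show ?thesis
      using r(2) by (fastforce simp: W_def double_diff_def)
  qed
  then have "\<And>e. e < r / 6 \<Longrightarrow> \<forall>x'\<in>cball x e. \<forall>y'\<in>cball y e. \<forall>a'\<in>cball a e. \<forall>b'\<in>cball b e.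
      \<forall>c'\<in>cball c e. \<forall>d'\<in>cball d e. - x' + y' \<noteq> double_diff a' b' c' d'"
    by (intro ballI)
  moreover have "\<forall>\<^sub>F e in at_right 0. e < r / 6"
    using r(1) by (intro order_tendstoD(2)[OF tendsto_ident_at]) simp
  ultimately show ?thesis
    by (rule eventually_mono[rotated])
qed

text \<open>
  The invariant of a Cantor scheme. Level \<open>n\<close> has \<open>2 ^ n\<close> closed balls around the points \<open>h i\<close>,
  which shrink to the curve \<open>\<phi>\<close>, and \<open>2 ^ n\<close> closed balls around the points \<open>f i\<close>, which shrink to
  \<open>K\<close>. The algebraic condition is imposed on whole balls, so that it passes to everything the balls
  shrink to.
\<close>

definition separated :: "nat \<Rightarrow> (nat \<Rightarrow> 'a::{metric_space, group_add}) \<Rightarrow> (nat \<Rightarrow> 'a) \<Rightarrow> real \<Rightarrow> bool" where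
  "separated n h f e \<longleftrightarrow>
     (\<forall>i<2 ^ n. \<forall>j<2 ^ n. i \<noteq> j \<longrightarrow> cball (f i) e \<inter> cball (f j) e = {}) \<and>
     (\<forall>i<2 ^ n. \<forall>j<2 ^ n. i \<noteq> j \<longrightarrow>
       (\<forall>a<2 ^ n. \<forall>b<2 ^ n. \<forall>c<2 ^ n. \<forall>d<2 ^ n.
         \<forall>x'\<in>cball (h i) e. \<forall>y'\<in>cball (h j) e.
         \<forall>a'\<in>cball (f a) e. \<forall>b'\<in>cball (f b) e. \<forall>c'\<in>cball (f c) e. \<forall>d'\<in>cball (f d) e.
           - x' + y' \<noteq> double_diff a' b' c' d'))"

lemma eventually_all_less_nat:
  "(\<forall>\<^sub>F x in F. \<forall>i<n. P i x) \<longleftrightarrow> (\<forall>i<n. \<forall>\<^sub>F x in F. P i x)" for n :: nat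
  using eventually_ball_finite_distrib[of "{..<n}" "\<lambda>x i. P i x" F] by (simp add: Ball_def)

lemma eventually_imp_const: "(\<forall>\<^sub>F x in F. P \<longrightarrow> Q x) \<longleftrightarrow> (P \<longrightarrow> (\<forall>\<^sub>F x in F. Q x))"
  by (cases P) simp_all

lemma separated_if_separated_centers:
  fixes h f :: "nat \<Rightarrow> 'a::{metric_space, topological_group_add}"
  assumes inj: "\<And>i j. i < 2 ^ n \<Longrightarrow> j < 2 ^ n \<Longrightarrow> i \<noteq> j \<Longrightarrow> f i \<noteq> f j"
    and avoid: "\<And>i j a b c d. i < 2 ^ n \<Longrightarrow> j < 2 ^ n \<Longrightarrow> i \<noteq> j \<Longrightarrow> a < 2 ^ n \<Longrightarrow> b < 2 ^ n \<Longrightarrow>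
      c < 2 ^ n \<Longrightarrow> d < 2 ^ n \<Longrightarrow> - h i + h j \<noteq> double_diff (f a) (f b) (f c) (f d)"
  shows "\<forall>\<^sub>F e in at_right 0. separated n h f e"
proof -
  have disj: "\<forall>\<^sub>F e in at_right 0. cball x e \<inter> cball y e = {}" if "x \<noteq> y" for x y :: 'a
  proof -
    have "\<forall>\<^sub>F e in at_right 0. e < dist x y / 2"
      using that by (intro order_tendstoD(2)[OF tendsto_ident_at]) simp
    then show ?thesis
    proof eventually_elim
      case (elim e)
      have "False" if "z \<in> cball x e" "z \<in> cball y e" for z
        using that elim dist_triangle[of x y z] by (simp add: dist_commute)
      then show ?case by blast
    qed
  qed
  show ?thesis
    unfolding separated_def eventually_conj_iff eventually_all_less_nat eventually_imp_const
    by (intro conjI allI impI disj double_diff_stable inj avoid)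
qed

text \<open>
  Every ball is split in two by translating its centre: \<open>h\<close> by one small \<open>v\<close>, \<open>f\<close> by one small
  \<open>w\<close>. The only new differences among the points of \<open>h\<close> that the old balls do not control are \<open>v\<close> and
  \<open>- v\<close>, so \<open>v\<close> merely has to avoid the finitely many values \<open>double_diff\<close> takes on \<open>f\<close>; this is
  possible because \<open>0\<close> is not isolated. With \<open>v\<close> fixed, every sufficiently small \<open>w\<close> preserves the
  finitely many inequalities by continuity.
\<close>

lemma separated_refine:
  fixes h f :: "nat \<Rightarrow> 'a::{metric_space, topological_group_add}"
  assumes nontriv: "at (0::'a) \<noteq> bot" and e: "e > 0" and sep: "separated n h f e"
  shows "\<exists>h' f' e'. separated (Suc n) h' f' e' \<and> 0 < e' \<and> e' \<le> e / 2 \<and>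
    (\<forall>k<2 ^ Suc n. dist (h' k) (h (k div 2)) \<le> e / 2 \<and> dist (f' k) (f (k div 2)) \<le> e / 2)"
proof -
  note disjoint = sep[unfolded separated_def, THEN conjunct1, rule_format]
    and separate = sep[unfolded separated_def, THEN conjunct2, rule_format]
  define ext where "ext g v k = g (k div 2) + (if odd k then v else 0)" for g and v :: 'a and k :: nat
  have half: "k div 2 < 2 ^ n" if "k < 2 ^ Suc n" for k :: nat
    using that by auto
  have close: "\<forall>\<^sub>F v in at 0. \<forall>k<2 ^ Suc n. dist (ext g v k) (g (k div 2)) \<le> e / 2" for g :: "nat \<Rightarrow> 'a"
    unfolding eventually_all_less_nat
  proof (intro allI impI)
    fix k :: nat
    have "((\<lambda>v. dist (ext g v k) (g (k div 2))) \<longlongrightarrow> dist (g (k div 2) + 0) (g (k div 2))) (at 0)"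
      unfolding ext_def by (cases "even k") (auto intro!: tendsto_eq_intros)
    then have "\<forall>\<^sub>F v in at 0. dist (ext g v k) (g (k div 2)) < e / 2"
      by (rule order_tendstoD) (use e in simp)
    then show "\<forall>\<^sub>F v in at 0. dist (ext g v k) (g (k div 2)) \<le> e / 2"
      by eventually_elim simp
  qed
  have "\<forall>\<^sub>F v in at 0. v \<noteq> double_diff (f a) (f b) (f c) (f d)" for a b c d
  proof (cases "double_diff (f a) (f b) (f c) (f d) = 0")
    case True
    then show ?thesis by (simp add: eventually_at_filter)
  next
    case False
    then show ?thesis
      by (intro tendsto_imp_eventually_ne[OF tendsto_ident_at]) simp
  qed
  then have "\<forall>\<^sub>F v in at 0. \<forall>a<2 ^ n. \<forall>b<2 ^ n. \<forall>c<2 ^ n. \<forall>d<2 ^ n. v \<noteq> double_diff (f a) (f b) (f c) (f d)"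
    by (simp add: eventually_all_less_nat)
  from eventually_conj[OF close[of h] this]
  obtain v where v: "\<And>k. k < 2 ^ Suc n \<Longrightarrow> dist (ext h v k) (h (k div 2)) \<le> e / 2"
    and v_avoid: "\<And>a b c d. a < 2 ^ n \<Longrightarrow> b < 2 ^ n \<Longrightarrow> c < 2 ^ n \<Longrightarrow> d < 2 ^ n \<Longrightarrow>
      v \<noteq> double_diff (f a) (f b) (f c) (f d)"
    by (rule exE[OF eventually_happens'[OF nontriv]]) (metis (no_types, lifting))
  \<comment> \<open>the case \<open>w = 0\<close> of the condition for the next level\<close>
  have avoid0: "- ext h v i + ext h v j \<noteq> double_diff (f a) (f b) (f c) (f d)"
    if ij: "i < 2 ^ Suc n" "j < 2 ^ Suc n" "i \<noteq> j" and abcd: "a < 2 ^ n" "b < 2 ^ n" "c < 2 ^ n" "d < 2 ^ n"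
    for i j a b c d
  proof (cases "i div 2 = j div 2")
    case False
    then show ?thesis
      by (intro separate[OF half[OF ij(1)] half[OF ij(2)] False abcd])
        (use v[OF ij(1)] v[OF ij(2)] e in \<open>auto simp: dist_commute\<close>)
  next
    case True
    then consider "even i" "odd j" | "odd i" "even j"
      using \<open>i \<noteq> j\<close> by (metis div_mult_mod_eq even_iff_mod_2_eq_zero odd_iff_mod_2_eq_one)
    then show ?thesis
    proof cases
      case 1
      then show ?thesis using True v_avoid[OF abcd] by (simp add: ext_def)
    next
      case 2
      have "v \<noteq> double_diff (f d) (f c) (f b) (f a)"
        using v_avoid abcd by blast
      \<comment> \<open>the set of values of \<open>double_diff\<close> on \<open>f\<close> is symmetric, so \<open>v\<close> avoids it iff \<open>- v\<close> does\<close>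
      moreover have "- double_diff (f a) (f b) (f c) (f d) = double_diff (f d) (f c) (f b) (f a)"
        by (simp add: double_diff_def minus_add add.assoc diff_conv_add_uminus del: add_uminus_conv_diff)
      ultimately have "- v \<noteq> double_diff (f a) (f b) (f c) (f d)"
        by (metis minus_minus)
      then show ?thesis using 2 True by (simp add: ext_def minus_add add.assoc)
    qed
  qed
  have avoid: "\<forall>\<^sub>F w in at 0. - ext h v i + ext h v j \<noteq> double_diff (ext f w a) (ext f w b) (ext f w c) (ext f w d)"
    if ij: "i < 2 ^ Suc n" "j < 2 ^ Suc n" "i \<noteq> j" and
      abcd: "a < 2 ^ Suc n" "b < 2 ^ Suc n" "c < 2 ^ Suc n" "d < 2 ^ Suc n"
    for i j a b c d
  proof -
    have ext: "((\<lambda>w. ext f w k) \<longlongrightarrow> f (k div 2)) (at 0)" for k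
      unfolding ext_def by (cases "even k") (auto intro!: tendsto_eq_intros)
    have "((\<lambda>w. double_diff (ext f w a) (ext f w b) (ext f w c) (ext f w d)) \<longlongrightarrow>
        double_diff (f (a div 2)) (f (b div 2)) (f (c div 2)) (f (d div 2))) (at 0)"
      unfolding double_diff_def diff_conv_add_uminus by (intro tendsto_intros ext)
    from tendsto_imp_eventually_ne[OF this avoid0[OF ij half half half half, OF abcd, symmetric]]
    show ?thesis by eventually_elim auto
  qed
  then have "\<forall>\<^sub>F w in at 0. \<forall>i<2 ^ Suc n. \<forall>j<2 ^ Suc n. i \<noteq> j \<longrightarrow> (\<forall>a<2 ^ Suc n. \<forall>b<2 ^ Suc n. \<forall>c<2 ^ Suc n.
      \<forall>d<2 ^ Suc n. - ext h v i + ext h v j \<noteq> double_diff (ext f w a) (ext f w b) (ext f w c) (ext f w d))"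
    unfolding eventually_all_less_nat eventually_imp_const by (intro allI impI)
  moreover have "\<forall>\<^sub>F w in at (0::'a). w \<noteq> 0"
    by (simp add: eventually_at_filter)
  ultimately have "\<forall>\<^sub>F w in at 0. w \<noteq> 0 \<and> (\<forall>k<2 ^ Suc n. dist (ext f w k) (f (k div 2)) \<le> e / 2) \<and>
      (\<forall>i<2 ^ Suc n. \<forall>j<2 ^ Suc n. i \<noteq> j \<longrightarrow> (\<forall>a<2 ^ Suc n. \<forall>b<2 ^ Suc n. \<forall>c<2 ^ Suc n.
      \<forall>d<2 ^ Suc n. - ext h v i + ext h v j \<noteq> double_diff (ext f w a) (ext f w b) (ext f w c) (ext f w d)))"
    using close[of f] by (intro eventually_conj)
  then obtain w where W: "w \<noteq> 0 \<and> (\<forall>k<2 ^ Suc n. dist (ext f w k) (f (k div 2)) \<le> e / 2) \<and>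
      (\<forall>i<2 ^ Suc n. \<forall>j<2 ^ Suc n. i \<noteq> j \<longrightarrow> (\<forall>a<2 ^ Suc n. \<forall>b<2 ^ Suc n. \<forall>c<2 ^ Suc n.
      \<forall>d<2 ^ Suc n. - ext h v i + ext h v j \<noteq> double_diff (ext f w a) (ext f w b) (ext f w c) (ext f w d)))"
    by (rule exE[OF eventually_happens'[OF nontriv]])
  note w0 = W[THEN conjunct1] and w = W[THEN conjunct2, THEN conjunct1, rule_format]
    and w_avoid = W[THEN conjunct2, THEN conjunct2, rule_format]
  have inj: "ext f w i \<noteq> ext f w j" if ij: "i < 2 ^ Suc n" "j < 2 ^ Suc n" "i \<noteq> j" for i j
  proof (cases "i div 2 = j div 2")
    case False
    have "ext f w i \<in> cball (f (i div 2)) e" "ext f w j \<in> cball (f (j div 2)) e"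
      using w[OF ij(1)] w[OF ij(2)] e by (auto simp: dist_commute)
    then show ?thesis
      using disjoint[OF half[OF ij(1)] half[OF ij(2)] False] by auto
  next
    case True
    then have "even i \<noteq> even j"
      using \<open>i \<noteq> j\<close> by (metis div_mult_mod_eq even_iff_mod_2_eq_zero odd_iff_mod_2_eq_one)
    then show ?thesis
      using True w0 by (auto simp: ext_def)
  qed
  have "\<forall>\<^sub>F e' in at_right 0. separated (Suc n) (ext h v) (ext f w) e'"
    by (intro separated_if_separated_centers inj w_avoid)
  moreover have "\<forall>\<^sub>F e' in at_right 0. e' < e / 2"
    using e by (intro order_tendstoD(2)[OF tendsto_ident_at]) simp
  moreover have "\<forall>\<^sub>F e' in at_right (0::real). 0 < e'"
    by (rule eventually_at_right_less)
  ultimately obtain e' where "separated (Suc n) (ext h v) (ext f w) e'" "e' < e / 2" "0 < e'"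
    using eventually_happens'[OF trivial_limit_at_right_real eventually_conj[OF _ eventually_conj]] by blast
  with v w show ?thesis
    by (intro exI[of _ "ext h v"] exI[of _ "ext f w"] exI[of _ e']) auto
qed

text \<open>
  The first \<open>n\<close> binary digits of \<open>t \<in> [0, 1)\<close>, read as a number: the node at level \<open>n\<close> of the
  binary tree through which the branch \<open>t\<close> passes. The node \<open>k\<close> at level \<open>n + 1\<close> lies below
  \<open>k div 2\<close>.
\<close>

definition cell :: "nat \<Rightarrow> real \<Rightarrow> nat" where
  "cell n t = nat \<lfloor>2 ^ n * t\<rfloor>"

lemma cell_less: "t \<in> {0..<1} \<Longrightarrow> cell n t < 2 ^ n"
proof -
  assume "t \<in> {0..<1}"
  then have "2 ^ n * t < 2 ^ n * 1" by (intro mult_strict_left_mono) auto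
  then have "\<lfloor>2 ^ n * t\<rfloor> < 2 ^ n"
    by (simp add: floor_less_iff)
  then show ?thesis
    unfolding cell_def using nat_less_iff by fastforce
qed

lemma cell_Suc_div: "t \<ge> 0 \<Longrightarrow> cell (Suc n) t div 2 = cell n t"
proof -
  assume "t \<ge> 0"
  have "\<lfloor>2 * (2 ^ n * t)\<rfloor> div 2 = \<lfloor>2 ^ n * t\<rfloor>"
    using floor_divide_real_eq_div[of 2 "2 * (2 ^ n * t)"] by simp
  moreover have "nat \<lfloor>2 * (2 ^ n * t)\<rfloor> div 2 = nat (\<lfloor>2 * (2 ^ n * t)\<rfloor> div 2)"
    using \<open>t \<ge> 0\<close> by (simp add: nat_div_distrib)
  ultimately show ?thesis
    by (simp add: cell_def mult.assoc)
qed

lemma cell_separates: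
  assumes "s \<in> {0..<1}" "t \<in> {0..<1}" "s \<noteq> t"
  shows "\<exists>n. cell n s \<noteq> cell n t"
proof -
  obtain n where n: "1 / \<bar>s - t\<bar> < 2 ^ n"
    using real_arch_pow[of 2] by auto
  then have "1 < \<bar>2 ^ n * s - 2 ^ n * t\<bar>"
    using \<open>s \<noteq> t\<close> by (simp add: divide_less_eq abs_mult flip: right_diff_distrib)
  then have "\<lfloor>2 ^ n * s\<rfloor> \<noteq> \<lfloor>2 ^ n * t\<rfloor>"
    by linarith
  then have "cell n s \<noteq> cell n t"
    using assms by (simp add: cell_def eq_nat_nat_iff)
  then show ?thesis ..
qed

text \<open>
  The centres along the branch of \<open>t\<close> form a Cauchy sequence, whose limit lies in all the balls.
  For fixed \<open>n\<close> the centre at level \<open>n\<close> is a step function of \<open>t\<close>, so the limit is a Borel function.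
\<close>

lemma borel_branch_function:
  fixes f :: "nat \<Rightarrow> nat \<Rightarrow> 'a::complete_space"
  assumes pos: "\<And>n. e n > 0" and half: "\<And>n. e (Suc n) \<le> e n / 2"
    and step: "\<And>n k. k < 2 ^ Suc n \<Longrightarrow> dist (f (Suc n) k) (f n (k div 2)) \<le> e n / 2"
  shows "\<exists>\<phi>::real \<Rightarrow> 'a. \<phi> \<in> borel_measurable borel \<and>
    (\<forall>t\<in>{0..<1}. \<forall>n. \<phi> t \<in> cball (f n (cell n t)) (e n))"
proof -
  define g where "g n t = (if t \<in> {0..<1} then f n (cell n t) else f 0 0)" for n and t :: real
  have g_Suc: "dist (g (Suc n) t) (g n t) \<le> e n / 2" for n t
  proof (cases "t \<in> {0..<1}")
    case True
    then show ?thesis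
      using step[OF cell_less[OF True], of n] cell_Suc_div[of t n] by (simp add: g_def)
  next
    case False
    then have "g m t = f 0 0" for m by (auto simp: g_def)
    then show ?thesis using less_imp_le[OF pos] by simp
  qed
  \<comment> \<open>the balls along a branch are nested: the radii at least halve, and centres move by at most half
    a radius\<close>
  have g_le: "dist (g (n + m) t) (g n t) \<le> e n - e (n + m)" for n m t
  proof (induction m)
    case (Suc m)
    then show ?case
      using dist_triangle[of "g (n + Suc m) t" "g n t" "g (n + m) t"] g_Suc[of "n + m" t] half[of "n + m"]
      by simp
  qed simp
  have "e n \<le> e 0 * (1 / 2) ^ n" for n
    by (induction n) (use half order_trans in \<open>fastforce+\<close>)
  then have "e \<longlonglongrightarrow> 0"
    by (intro tendsto_sandwich[of "\<lambda>_. 0" e sequentially "\<lambda>n. e 0 * (1 / 2) ^ n"])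
      (auto intro!: tendsto_eq_intros LIMSEQ_power_zero always_eventually less_imp_le[OF pos])
  have g_dist: "dist (g m t) (g n t) \<le> e n" if "n \<le> m" for m n t
    using g_le[of n "m - n" t] that pos[of m] by simp
  have "Cauchy (\<lambda>n. g n t)" for t
  proof (rule metric_CauchyI)
    fix r :: real assume "r > 0"
    then obtain N where N: "e N < r / 2"
      using order_tendstoD(2)[OF \<open>e \<longlonglongrightarrow> 0\<close>, of "r / 2"] by (auto simp: eventually_sequentially)
    have "dist (g m t) (g n t) < r" if "m \<ge> N" "n \<ge> N" for m n
      using dist_triangle2[of "g m t" "g n t" "g N t"] g_dist[OF that(1), of t] g_dist[OF that(2), of t] N
      by linarith
    then show "\<exists>M. \<forall>m\<ge>M. \<forall>n\<ge>M. dist (g m t) (g n t) < r" by blast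
  qed
  then have lim: "(\<lambda>n. g n t) \<longlonglongrightarrow> lim (\<lambda>n. g n t)" for t
    by (simp add: Cauchy_convergent convergent_LIMSEQ_iff[symmetric])
  have "(\<lambda>t. lim (\<lambda>n. g n t)) \<in> borel_measurable borel"
  proof (rule borel_measurable_LIMSEQ_metric[OF _ lim])
    show "g n \<in> borel_measurable borel" for n
    proof -
      have "cell n \<in> measurable borel (count_space UNIV)"
        unfolding cell_def by measurable
      then have "(\<lambda>t. f n (cell n t)) \<in> borel_measurable borel"
        by (rule measurable_compose) simp
      then show ?thesis
        unfolding g_def by (intro measurable_If) auto
    qed
  qed
  moreover have "lim (\<lambda>n. g n t) \<in> cball (f n (cell n t)) (e n)" if "t \<in> {0..<1}" for n t
  proof -
    have "dist (lim (\<lambda>n. g n t)) (g n t) \<le> e n"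
      by (rule tendsto_upperbound[OF tendsto_dist[OF lim tendsto_const]])
        (auto simp: eventually_sequentially intro: g_dist)
    then show ?thesis
      using that by (simp add: g_def dist_commute)
  qed
  ultimately show ?thesis by blast
qed

text \<open>
  Iterating \<open>separated_refine\<close> gives a Cantor scheme: \<open>\<phi>\<close> and \<open>\<psi>\<close> follow its two families of balls
  along the binary expansion of \<open>t\<close>, and distinct parameters end up in distinct balls at some level.
  The set \<open>K\<close> consists of the limits of all branches of \<open>\<psi>\<close>'s family, including the second branch at dyadic points,
  which no \<open>\<psi> t\<close> follows. It is used in place of the image of \<open>\<psi>\<close> because it is visibly closed.
\<close>

lemma separated_curves:
  assumes nontriv: "at (0::'a::{polish_space, topological_group_add}) \<noteq> bot"
  obtains \<phi> \<psi> :: "real \<Rightarrow> 'a::{polish_space, topological_group_add}" and K where "\<phi> \<in> borel_measurable borel"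
    and "\<psi> \<in> borel_measurable borel" "closed K" "\<psi> ` {0..<1} \<subseteq> K" "inj_on \<psi> {0..<1}"
    and "\<And>s t a b c d. s \<in> {0..<1} \<Longrightarrow> t \<in> {0..<1} \<Longrightarrow> s \<noteq> t \<Longrightarrow>
      a \<in> K \<Longrightarrow> b \<in> K \<Longrightarrow> c \<in> K \<Longrightarrow> d \<in> K \<Longrightarrow> - \<phi> s + \<phi> t \<noteq> - a + b - c + d"
proof -
  let ?P = "\<lambda>n x. 0 < snd (snd x) \<and> separated n (fst x :: nat \<Rightarrow> 'a) (fst (snd x)) (snd (snd x))"
  let ?Q = "\<lambda>n x y. snd (snd y) \<le> snd (snd x) / 2 \<and> (\<forall>k<2 ^ Suc n.
      dist ((fst y :: nat \<Rightarrow> 'a) k) (fst x (k div 2)) \<le> snd (snd x) / 2 \<and>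
      dist ((fst (snd y) :: nat \<Rightarrow> 'a) k) (fst (snd x) (k div 2)) \<le> snd (snd x) / 2)"
  have "\<exists>S. \<forall>n. ?P n (S n) \<and> ?Q n (S n) (S (Suc n))"
  proof (rule dependent_nat_choice)
    have "?P 0 (\<lambda>_. 0, \<lambda>_. 0, 1)"
      by (simp add: separated_def)
    then show "\<exists>x. ?P 0 x"
      by (rule exI[where x = "(\<lambda>_. 0, \<lambda>_. 0, 1)"])
  next
    fix x :: "(nat \<Rightarrow> 'a) \<times> (nat \<Rightarrow> 'a) \<times> real" and n
    assume "?P n x"
    then have x: "0 < snd (snd x)" "separated n (fst x) (fst (snd x)) (snd (snd x))"
      by simp_all
    from separated_refine[OF nontriv x] obtain h' f' e' where
      "separated (Suc n) h' f' e' \<and> 0 < e' \<and> e' \<le> snd (snd x) / 2 \<and>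
        (\<forall>k<2 ^ Suc n. dist (h' k) (fst x (k div 2)) \<le> snd (snd x) / 2 \<and>
          dist (f' k) (fst (snd x) (k div 2)) \<le> snd (snd x) / 2)"
      by (elim exE) (rule that)
    then have "?P (Suc n) (h', f', e') \<and> ?Q n x (h', f', e')"
      unfolding fst_conv snd_conv by (elim conjE) (intro conjI; assumption)
    then show "\<exists>y. ?P (Suc n) y \<and> ?Q n x y"
      by (rule exI[where x = "(h', f', e')"])
  qed
  then obtain S where S: "\<forall>n. ?P n (S n) \<and> ?Q n (S n) (S (Suc n))" by (rule exE)
  define h f e where "h n = fst (S n)" and "f n = fst (snd (S n))" and "e n = snd (snd (S n))" for n
  have pos: "e n > 0" and sep: "separated n (h n) (f n) (e n)" for n
    unfolding h_def f_def e_def using S[rule_format, of n] by blast+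
  note disjoint = sep[unfolded separated_def, THEN conjunct1, rule_format]
    and avoid = sep[unfolded separated_def, THEN conjunct2, rule_format]
  have half: "e (Suc n) \<le> e n / 2"
    and step: "\<And>k. k < 2 ^ Suc n \<Longrightarrow> dist (h (Suc n) k) (h n (k div 2)) \<le> e n / 2"
      "\<And>k. k < 2 ^ Suc n \<Longrightarrow> dist (f (Suc n) k) (f n (k div 2)) \<le> e n / 2" for n
    unfolding h_def f_def e_def using S[rule_format, of n] by blast+
  obtain \<phi> :: "real \<Rightarrow> 'a" where \<phi>: "\<phi> \<in> borel_measurable borel"
    "\<And>t n. t \<in> {0..<1} \<Longrightarrow> \<phi> t \<in> cball (h n (cell n t)) (e n)"
    using borel_branch_function[of e h, OF pos half step(1)] by blast
  obtain \<psi> :: "real \<Rightarrow> 'a" where \<psi>: "\<psi> \<in> borel_measurable borel"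
    "\<And>t n. t \<in> {0..<1} \<Longrightarrow> \<psi> t \<in> cball (f n (cell n t)) (e n)"
    using borel_branch_function[of e f, OF pos half step(2)] by blast
  define K where "K = (\<Inter>n. \<Union>k<2 ^ n. cball (f n k) (e n))"
  have "closed K"
    unfolding K_def by (intro closed_INT ballI closed_UN) auto
  moreover have "\<psi> ` {0..<1} \<subseteq> K"
    using \<psi>(2) cell_less unfolding K_def by blast
  moreover have "inj_on \<psi> {0..<1}"
  proof (rule inj_onI, rule ccontr)
    fix s t :: real assume st: "s \<in> {0..<1}" "t \<in> {0..<1}" "\<psi> s = \<psi> t" "s \<noteq> t"
    then obtain n where "cell n s \<noteq> cell n t"
      using cell_separates by blast
    then have "cball (f n (cell n s)) (e n) \<inter> cball (f n (cell n t)) (e n) = {}"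
      by (intro disjoint cell_less st)
    then show False
      using \<psi>(2)[OF st(1), of n] \<psi>(2)[OF st(2), of n] st(3) by auto
  qed
  moreover have "- \<phi> s + \<phi> t \<noteq> - a + b - c + d"
    if st: "s \<in> {0..<1}" "t \<in> {0..<1}" "s \<noteq> t" and abcd: "a \<in> K" "b \<in> K" "c \<in> K" "d \<in> K" for s t a b c d
  proof -
    obtain n where n: "cell n s \<noteq> cell n t"
      using cell_separates st by blast
    \<comment> \<open>level \<open>n\<close>, at which \<open>s\<close> and \<open>t\<close> have separated, already decides the inequality\<close>
    have "\<exists>i<2 ^ n. z \<in> cball (f n i) (e n)" if "z \<in> K" for z
      using that unfolding K_def by blast
    from this[OF abcd(1)] this[OF abcd(2)] this[OF abcd(3)] this[OF abcd(4)]
    obtain i j k l where "i < 2 ^ n" "j < 2 ^ n" "k < 2 ^ n" "l < 2 ^ n"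
      and "a \<in> cball (f n i) (e n)" "b \<in> cball (f n j) (e n)" "c \<in> cball (f n k) (e n)" "d \<in> cball (f n l) (e n)"
      by (elim exE conjE) (rule that)
    then show ?thesis
      unfolding double_diff_def[symmetric]
      by (rule avoid[OF cell_less[OF st(1)] cell_less[OF st(2)] n _ _ _ _ \<phi>(2)[OF st(1)] \<phi>(2)[OF st(2)]])
  qed
  ultimately show ?thesis
    by (intro that[OF \<phi>(1) \<psi>(1)])
qed

section \<open>Cardinality of closed sets and transfinite selection\<close>

text \<open>
  A closed set is determined by the members of a countable base that are disjoint from it.
\<close>

lemma lepoll_reals_closed_sets:
  "{A :: 'a::second_countable_topology set. closed A} \<lesssim> (UNIV :: real set)"
proof -
  obtain B :: "'a set set" where B: "countable B" "topological_basis B"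
    using ex_countable_basis by blast
  define code where "code A = to_nat_on B ` {b \<in> B. b \<inter> A = {}}" for A
  have compl: "- A = \<Union> {b \<in> B. b \<inter> A = {}}" if A: "closed A" for A
  proof -
    obtain B' where "B' \<subseteq> B" "\<Union> B' = - A"
      using B(2) open_Compl[OF A] unfolding topological_basis_def by metis
    then show ?thesis by blast
  qed
  have "inj_on code {A. closed A}"
  proof (rule inj_onI)
    fix A A' :: "'a set"
    assume A: "A \<in> {A. closed A}" "A' \<in> {A. closed A}" and "code A = code A'"
    then have "{b \<in> B. b \<inter> A = {}} = {b \<in> B. b \<inter> A' = {}}"
      unfolding code_def by (subst (asm) inj_on_image_eq_iff[OF inj_on_to_nat_on[OF B(1)]]) auto
    then have "- A = - A'"
      using compl A by simp
    then show "A = A'" by simp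
  qed
  then have "{A :: 'a set. closed A} \<lesssim> (UNIV :: nat set set)"
    unfolding lepoll_def by blast
  then show ?thesis
    using nat_sets_eqpoll_reals lepoll_trans2 by blast
qed

lemma lepoll_reals_UNIV: "(UNIV :: 'a::{second_countable_topology, t1_space} set) \<lesssim> (UNIV :: real set)"
proof -
  have "(UNIV :: 'a set) \<lesssim> {A :: 'a set. closed A}"
    unfolding lepoll_def by (rule exI[of _ "\<lambda>x. {x}"]) auto
  then show ?thesis
    using lepoll_reals_closed_sets lepoll_trans by blast
qed

lemma reals_times_lepoll_reals: "(UNIV :: real set) \<times> (UNIV :: real set) \<lesssim> (UNIV :: real set)"
proof -
  have "ordIso2 (card_of ((UNIV :: real set) \<times> (UNIV :: real set))) (card_of (UNIV :: real set))"
    by (rule card_of_Times_same_infinite) (simp add: infinite_UNIV_char_0)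
  then show ?thesis
    using eqpoll_iff_card_of_ordIso eqpoll_imp_lepoll by blast
qed

text \<open>
  The distribution function \<open>F t\<close>, the measure of \<open>A \<inter> (-\<infinity>, t]\<close>, is continuous and increases from
  \<open>0\<close> to the measure of \<open>A\<close>. It is constant on the gaps of \<open>A\<close>, so it takes all its values
  strictly between these bounds on \<open>A\<close> itself, and \<open>A\<close> maps onto an interval.
\<close>

lemma reals_lepoll_closed_positive_measure:
  fixes A :: "real set"
  assumes A: "closed A" "A \<subseteq> {0..<1}" "emeasure lborel A > 0"
  shows "(UNIV :: real set) \<lesssim> A"
proof -
  define F where "F t = measure lborel (A \<inter> {..t})" for t
  have A_sets[measurable]: "A \<in> sets borel" using A(1) by (rule borel_closed)
  have fm: "B \<in> fmeasurable lborel" if "B \<in> sets borel" "B \<subseteq> {0..<1}" for B :: "real set"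
  proof (rule fmeasurableI2)
    show "{0..<1::real} \<in> fmeasurable lborel" by (rule fmeasurableI) auto
  qed (use that in auto)
  have F_add: "F t = F s + measure lborel (A \<inter> {s<..t})" if "s \<le> t" for s t
  proof -
    have "A \<inter> {..t} = (A \<inter> {..s}) \<union> (A \<inter> {s<..t})"
      using that by auto
    moreover have "A \<inter> {..s} \<in> fmeasurable lborel" "A \<inter> {s<..t} \<in> fmeasurable lborel"
      using A(2) by (auto intro!: fm)
    ultimately have "F t = F s + measure lborel (A \<inter> {s<..t}) - measure lborel ((A \<inter> {..s}) \<inter> (A \<inter> {s<..t}))"
      by (simp only: F_def measure_Un3)
    moreover have "(A \<inter> {..s}) \<inter> (A \<inter> {s<..t}) = {}" by auto
    ultimately show ?thesis by simp
  qed
  have F_diff: "F s \<le> F t \<and> F t \<le> F s + (t - s)" if "s \<le> t" for s t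
  proof -
    have "measure lborel (A \<inter> {s<..t}) \<le> measure lborel {s<..t}"
      by (intro measure_mono_fmeasurable) (use that in \<open>auto simp: fmeasurable_def\<close>)
    then show ?thesis
      using F_add[OF that] that by simp
  qed
  have "1-lipschitz_on UNIV F"
  proof (rule lipschitz_onI)
    show "dist (F s) (F t) \<le> 1 * dist s t" for s t
      using F_diff[of s t] F_diff[of t s] by (cases "s \<le> t") (auto simp: dist_real_def)
  qed simp
  then have cont: "continuous_on S F" for S
    using lipschitz_on_continuous_on continuous_on_subset subset_UNIV by metis
  have F0: "F (-1) = 0"
  proof -
    have "A \<inter> {..-1} = {}" using A(2) by fastforce
    then show ?thesis by (simp add: F_def)
  qed
  have F1: "F 1 > 0"
  proof -
    have "A \<inter> {..1} = A" using A(2) by fastforce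
    then show ?thesis
      using A(3) emeasure_eq_measure2[OF fm[OF A_sets A(2)]] by (simp add: F_def)
  qed
  have "{0<..<F 1} \<subseteq> F ` A"
  proof
    fix v assume v: "v \<in> {0<..<F 1}"
    then obtain t where t: "F t = v"
      using IVT'[of F "-1" v 1] F0 cont by auto
    have ne: "A \<inter> {..t} \<noteq> {}"
      using v t by (auto simp: F_def)
    \<comment> \<open>the last point of \<open>A\<close> before \<open>t\<close>, where \<open>F\<close> has the same value as at \<open>t\<close>\<close>
    define s where "s = Sup (A \<inter> {..t})"
    have s: "s \<in> A \<inter> {..t}"
      unfolding s_def by (rule closed_contains_Sup) (use ne A(1) in \<open>auto intro: bdd_aboveI\<close>)
    have "A \<inter> {..t} = A \<inter> {..s}"
      using s cSup_upper[of _ "A \<inter> {..t}"] by (force simp: s_def intro: bdd_aboveI)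
    then have "F s = v"
      using t by (simp add: F_def)
    with s show "v \<in> F ` A" by blast
  qed
  then have "{0<..<F 1} \<lesssim> A"
    by (meson image_lepoll subset_imp_lepoll lepoll_trans)
  moreover have "(UNIV :: real set) \<lesssim> {0<..<F 1}"
  proof -
    obtain f where "bij_betw f {0<..<F 1} {-pi/2<..<pi/2}"
      using bij_betw_open_intervals[OF F1, of "-pi/2" "pi/2"] pi_gt_zero by auto
    then have "bij_betw (tan \<circ> f) {0<..<F 1} UNIV"
      using bij_betw_tan by (rule bij_betw_trans)
    then have "(UNIV :: real set) \<approx> {0<..<F 1}"
      by (meson eqpoll_def eqpoll_sym)
    then show ?thesis by (rule eqpoll_imp_lepoll)
  qed
  ultimately show ?thesis
    using lepoll_trans by blast
qed

text \<open>
  Recursion along a well-order of \<open>T\<close> of minimal type: each proper initial segment has smaller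
  cardinality than \<open>T\<close>, so the points chosen so far form a set \<open>Y \<prec> T\<close>.
\<close>

lemma transfinite_selection:
  fixes S :: "'t \<Rightarrow> 'a set"
  assumes avoid: "\<And>t Y. t \<in> T \<Longrightarrow> Y \<prec> T \<Longrightarrow> \<exists>x\<in>S t. \<forall>y\<in>Y. \<not> R y x"
    and sym: "\<And>x y. R x y \<Longrightarrow> R y x"
  obtains f where "\<And>t. t \<in> T \<Longrightarrow> f t \<in> S t"
    and "\<And>t u. t \<in> T \<Longrightarrow> u \<in> T \<Longrightarrow> t \<noteq> u \<Longrightarrow> \<not> R (f t) (f u)"
proof -
  define r where "r = card_of T"
  have r: "Card_order r" "Well_order r" "Field r = T"
    by (simp_all add: r_def card_of_Card_order card_of_Well_order Field_card_of
        card_of_card_order_on card_of_well_order_on)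
  have "wf (r - Id)"
    using r(2) by (simp add: well_order_on_def)
  moreover have "(P :: ('t \<Rightarrow> 'a) \<Rightarrow> 't \<Rightarrow> 'a \<Rightarrow> bool) f x z = P g x z"
    if "P = (\<lambda>f t x. t \<in> T \<longrightarrow> x \<in> S t \<and> (\<forall>u\<in>underS r t. \<not> R (f u) x))"
      "\<And>z. (z, x) \<in> r - Id \<Longrightarrow> f z = g z" for P f g x z
    using that by (auto simp: underS_def)
  moreover have "\<exists>x. t \<in> T \<longrightarrow> x \<in> S t \<and> (\<forall>u\<in>underS r t. \<not> R (f u) x)" for t and f :: "'t \<Rightarrow> 'a"
  proof (cases "t \<in> T")
    case True
    have "ordLess2 (card_of (underS r t)) r"
      using r True by (intro card_of_underS) auto
    then have "underS r t \<prec> T"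
      unfolding r_def
      by (metis card_of_ordLeq eqpoll_iff_card_of_ordIso lepoll_def lesspoll_def not_ordLess_ordIso ordLess_imp_ordLeq)
    then have "f ` underS r t \<prec> T"
      using image_lepoll lesspoll_trans1 by blast
    from avoid[OF True this] show ?thesis by blast
  qed simp
  ultimately obtain f where f: "\<forall>t. t \<in> T \<longrightarrow> f t \<in> S t \<and> (\<forall>u\<in>underS r t. \<not> R (f u) (f t))"
    using dependent_wf_choice[of "r - Id" "\<lambda>f t x. t \<in> T \<longrightarrow> x \<in> S t \<and> (\<forall>u\<in>underS r t. \<not> R (f u) x)"]
    by blast
  have "\<not> R (f t) (f u)" if "t \<in> T" "u \<in> T" "t \<noteq> u" for t u
  proof -
    have "(t, u) \<in> r \<or> (u, t) \<in> r"
      using r(2,3) that by (auto simp: well_order_on_def linear_order_on_def total_on_def)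
    then show ?thesis
      using f that sym[of "f t" "f u"] by (auto simp: underS_def)
  qed
  with f show ?thesis by (intro that[of f]) auto
qed

section \<open>The set \<open>X\<close>\<close>

text \<open>
  The two properties pull in opposite directions: the first makes \<open>X\<close> sparse relative to \<open>K\<close>, the
  second makes every \<open>{t. m + \<phi> t \<in> X}\<close> have full outer measure in \<open>[0, 1)\<close>. A point \<open>y\<close> chosen
  earlier rules out at most one parameter \<open>a \<in> A\<close>, because \<open>m + \<phi> a\<close> and \<open>m + \<phi> a'\<close> lying in one
  \<open>y - K + K\<close> would make \<open>- \<phi> a + \<phi> a'\<close> a forbidden value.
\<close>

lemma exists_sparse_transversal:
  fixes \<phi> :: "real \<Rightarrow> 'a::{polish_space, topological_group_add}"
  assumes avoid: "\<And>s t a b c d. s \<in> {0..<1} \<Longrightarrow> t \<in> {0..<1} \<Longrightarrow> s \<noteq> t \<Longrightarrow>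
      a \<in> K \<Longrightarrow> b \<in> K \<Longrightarrow> c \<in> K \<Longrightarrow> d \<in> K \<Longrightarrow> - \<phi> s + \<phi> t \<noteq> - a + b - c + d"
  obtains X where "\<And>x y a b. x \<in> X \<Longrightarrow> y \<in> X \<Longrightarrow> x \<noteq> y \<Longrightarrow> a \<in> K \<Longrightarrow> b \<in> K \<Longrightarrow> - x + y \<noteq> - a + b"
    and "\<And>m A. closed A \<Longrightarrow> A \<subseteq> {0..<1} \<Longrightarrow> emeasure lborel A > 0 \<Longrightarrow> \<exists>a\<in>A. m + \<phi> a \<in> X"
proof -
  define R where "R x y \<longleftrightarrow> (\<exists>a\<in>K. \<exists>b\<in>K. - x + y = - a + b)" for x y
  define T where "T = (UNIV :: 'a set) \<times> {A :: real set. closed A \<and> A \<subseteq> {0..<1} \<and> emeasure lborel A > 0}"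
  have "T \<lesssim> (UNIV :: real set) \<times> (UNIV :: real set)"
    unfolding T_def
    by (intro times_lepoll_mono lepoll_reals_UNIV lepoll_trans[OF subset_imp_lepoll lepoll_reals_closed_sets]) auto
  then have T_le: "T \<lesssim> (UNIV :: real set)"
    using reals_times_lepoll_reals lepoll_trans by blast
  have R_sym: "R y x" if "R x y" for x y
  proof -
    obtain a b where "a \<in> K" "b \<in> K" and xy: "- x + y = - a + b"
      using \<open>R x y\<close> unfolding R_def by blast
    have "- y + x = - (- x + y)" by (simp add: minus_add)
    also have "\<dots> = - b + a" unfolding xy by (simp add: minus_add)
    finally show ?thesis
      using \<open>a \<in> K\<close> \<open>b \<in> K\<close> unfolding R_def by blast
  qed
  define S where "S = (\<lambda>(m, A). (\<lambda>a. m + \<phi> a) ` A)"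
  have R_avoid: "\<exists>x\<in>S t. \<forall>y\<in>Y. \<not> R y x" if t: "t \<in> T" and "Y \<prec> T" for t and Y :: "'a set"
  proof -
    obtain m A where tmA: "t = (m, A)" by fastforce
    with t have A: "closed A" "A \<subseteq> {0..<1}" "emeasure lborel A > 0"
      by (auto simp: T_def)
    have "\<exists>a\<in>A. \<forall>y\<in>Y. \<not> R y (m + \<phi> a)"
    proof (rule ccontr)
      assume "\<not> ?thesis"
      then obtain y where y: "\<And>a. a \<in> A \<Longrightarrow> y a \<in> Y \<and> R (y a) (m + \<phi> a)"
        by metis
      \<comment> \<open>if every \<open>a\<close> were ruled out by some \<open>y a\<close>, then \<open>A\<close>, and with it \<open>T\<close>, would embed into \<open>Y\<close>\<close>
      have "inj_on y A"
      proof (rule inj_onI, rule ccontr)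
        fix a a' assume a: "a \<in> A" "a' \<in> A" "y a = y a'" "a \<noteq> a'"
        obtain p q where pq: "p \<in> K" "q \<in> K" "- y a + (m + \<phi> a) = - p + q"
          using y[OF a(1)] unfolding R_def by blast
        obtain p' q' where pq': "p' \<in> K" "q' \<in> K" "- y a + (m + \<phi> a') = - p' + q'"
          using y[OF a(2)] a(3) unfolding R_def by auto
        have "- \<phi> a + \<phi> a' = - (- y a + (m + \<phi> a)) + (- y a + (m + \<phi> a'))"
          by (simp add: minus_add add.assoc diff_conv_add_uminus del: add_uminus_conv_diff)
        also have "\<dots> = - q + p - p' + q'"
          unfolding pq(3) pq'(3) by (simp add: minus_add add.assoc diff_conv_add_uminus del: add_uminus_conv_diff)
        finally show False
          using avoid[of a a' q p p' q'] a pq pq' A(2) by blast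
      qed
      then have "A \<lesssim> Y"
        unfolding lepoll_def using y by blast
      then have "(UNIV :: real set) \<lesssim> Y"
        using reals_lepoll_closed_positive_measure[OF A] lepoll_trans by blast
      then have "T \<lesssim> Y"
        using T_le lepoll_trans by blast
      with \<open>Y \<prec> T\<close> show False
        by (meson lesspoll_def lepoll_antisym)
    qed
    then show ?thesis
      by (auto simp: tmA S_def)
  qed
  obtain f where f: "\<And>t. t \<in> T \<Longrightarrow> f t \<in> S t"
    and f_R: "\<And>t u. t \<in> T \<Longrightarrow> u \<in> T \<Longrightarrow> t \<noteq> u \<Longrightarrow> \<not> R (f t) (f u)"
    by (rule transfinite_selection[where T = T and S = S and R = R, OF R_avoid R_sym]; (assumption | rule that))
  have "\<exists>a\<in>A. m + \<phi> a \<in> f ` T" if "closed A" "A \<subseteq> {0..<1}" "emeasure lborel A > 0" for m A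
  proof -
    have "(m, A) \<in> T" using that by (simp add: T_def)
    with f[of "(m, A)"] show ?thesis by (force simp: S_def)
  qed
  moreover have "- x + y \<noteq> - a + b" if "x \<in> f ` T" "y \<in> f ` T" "x \<noteq> y" "a \<in> K" "b \<in> K" for x y a b
    using that f_R unfolding R_def by blast
  ultimately show ?thesis by (intro that)
qed

abbreviation uniform01 :: "real measure" where
  "uniform01 \<equiv> uniform_measure lborel {0..<1}"

lemma prob_space_uniform01: "prob_space uniform01"
  by (rule prob_space_uniform_measure) auto

text \<open>
  The witness is the image of Lebesgue measure under \<open>\<psi>\<close>: it has no atoms because \<open>\<psi>\<close> is injective,
  it is concentrated on \<open>K\<close>, and a left translate of \<open>X\<close> meets \<open>K\<close> in at most one point.
\<close>

lemma naively_left_haar_null_if_sparse: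
  fixes X :: "'a::{polish_space, topological_group_add} set"
  assumes \<psi>[measurable]: "\<psi> \<in> borel_measurable borel" and K: "closed K" "\<psi> ` {0..<1} \<subseteq> K" "inj_on \<psi> {0..<1::real}"
    and sparse: "\<And>x y a b. x \<in> X \<Longrightarrow> y \<in> X \<Longrightarrow> x \<noteq> y \<Longrightarrow> a \<in> K \<Longrightarrow> b \<in> K \<Longrightarrow> - x + y \<noteq> - a + b"
  shows "naively_left_haar_null X"
proof -
  define \<mu> where "\<mu> = distr uniform01 borel \<psi>"
  interpret uniform01: prob_space uniform01 by (rule prob_space_uniform01)
  have "borel_prob \<mu>"
    unfolding borel_prob_def \<mu>_def by (auto intro!: uniform01.prob_space_distr)
  moreover have "(\<lambda>x. g + x) ` X \<in> null_sets (completion \<mu>)" for g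
  proof -
    have unique: "z = z'" if zz': "z \<in> (\<lambda>x. g + x) ` X \<inter> K" "z' \<in> (\<lambda>x. g + x) ` X \<inter> K" for z z'
    proof (rule ccontr)
      assume "z \<noteq> z'"
      obtain x x' where "x \<in> X" "x' \<in> X" and eq: "z = g + x" "z' = g + x'"
        using zz' by blast
      moreover have "- x + x' = - z + z'"
        unfolding eq by (simp add: minus_add add.assoc diff_conv_add_uminus del: add_uminus_conv_diff)
      ultimately show False
        using sparse[of x x' z z'] zz' \<open>z \<noteq> z'\<close> by auto
    qed
    then obtain z where z: "(\<lambda>x. g + x) ` X \<inter> K \<subseteq> {z}"
      by blast
    have "finite (\<psi> -` {z} \<inter> {0..<1})"
      using K(3) by (intro finite_vimage_IntI) auto
    moreover have "{0..<1} \<inter> \<psi> -` (- K \<union> {z}) \<subseteq> \<psi> -` {z} \<inter> {0..<1}"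
      using K(2) by blast
    ultimately have "finite ({0..<1} \<inter> \<psi> -` (- K \<union> {z}))"
      using finite_subset by blast
    moreover have sets: "- K \<union> {z} \<in> sets borel"
      using K(1) by auto
    ultimately have "- K \<union> {z} \<in> null_sets \<mu>"
      unfolding \<mu>_def using measurable_sets_borel[OF \<psi> sets]
      by (intro null_setsI) (simp_all add: emeasure_distr finite_imp_null_set_lborel[THEN null_setsD1])
    moreover have "(\<lambda>x. g + x) ` X \<subseteq> - K \<union> {z}"
      using z by blast
    ultimately show ?thesis
      unfolding null_sets_completion_iff2 by blast
  qed
  ultimately show ?thesis
    unfolding naively_left_haar_null_def by blast
qed

text \<open>
  Fubini is applied twice to \<open>{(m, t). m + \<phi> t \<in> _}\<close> and a measure \<open>\<mu>\<close> witnessing that \<open>U \<supseteq> X\<close> is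
  Haar null. Integrating over \<open>m\<close> first shows that the convolution \<open>\<rho>\<close> vanishes on \<open>U\<close>, since the
  sections are right translates of \<open>U\<close>. Integrating over \<open>t\<close> first then yields one \<open>m\<close> for which
  \<open>m + \<phi> t\<close> avoids \<open>U\<close> for almost all \<open>t\<close>. Universal measurability serves to replace \<open>U\<close> by Borel
  sets from inside and from outside that are equal up to a \<open>\<rho>\<close>-null set.
\<close>

lemma not_haar_null_if_transversal:
  fixes X :: "'a::{polish_space, topological_group_add} set"
  assumes \<phi>[measurable]: "\<phi> \<in> borel_measurable borel"
    and meets: "\<And>m A. closed A \<Longrightarrow> A \<subseteq> {0..<1::real} \<Longrightarrow> emeasure lborel A > 0 \<Longrightarrow> \<exists>a\<in>A. m + \<phi> a \<in> X"
  shows "\<not> haar_null X"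
proof
  assume "haar_null X"
  then obtain U \<mu> where U: "universally_measurable U" "X \<subseteq> U" and \<mu>: "borel_prob \<mu>"
    and null: "\<And>g h. (\<lambda>x. g + x + h) ` U \<in> null_sets (completion \<mu>)"
    unfolding haar_null_def by blast
  have [measurable_cong]: "sets \<mu> = sets borel" and "prob_space \<mu>"
    using \<mu> by (auto simp: borel_prob_def)
  interpret \<mu>: prob_space \<mu> by fact
  interpret uniform01: prob_space uniform01 by (rule prob_space_uniform01)
  interpret pair_prob_space \<mu> uniform01 ..
  define \<rho> where "\<rho> = distr (\<mu> \<Otimes>\<^sub>M uniform01) borel (\<lambda>(m, t). m + \<phi> t)"
  have meas[measurable]: "(\<lambda>(m, t). m + \<phi> t) \<in> measurable (\<mu> \<Otimes>\<^sub>M uniform01) borel"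
    by measurable
  have "borel_prob \<rho>"
    unfolding borel_prob_def \<rho>_def by (auto intro!: prob_space_distr meas)
  then have "U \<in> sets (completion \<rho>)"
    using U(1) unfolding universally_measurable_def by blast
  then obtain S N N' where SN: "U = S \<union> N" "N \<subseteq> N'" "N' \<in> null_sets \<rho>" "S \<in> sets \<rho>"
    by (rule sets_completionE)
  have sets_\<rho>: "sets \<rho> = sets borel" by (simp add: \<rho>_def)
  have space: "space (\<mu> \<Otimes>\<^sub>M uniform01) = UNIV"
    using sets_eq_imp_space_eq[OF \<open>sets \<mu> = sets borel\<close>] by (simp add: space_pair_measure)
  have vimage: "(\<lambda>(m, t). m + \<phi> t) -` B \<in> sets (\<mu> \<Otimes>\<^sub>M uniform01)" if "B \<in> sets borel" for B
    using measurable_sets[OF meas that] by (simp add: space)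
  have "emeasure \<rho> S = emeasure (\<mu> \<Otimes>\<^sub>M uniform01) ((\<lambda>(m, t). m + \<phi> t) -` S)"
    using SN(4) unfolding sets_\<rho> unfolding \<rho>_def by (simp add: emeasure_distr space)
  also have "\<dots> = (\<integral>\<^sup>+t. emeasure \<mu> ((\<lambda>m. (m, t)) -` ((\<lambda>(m, t). m + \<phi> t) -` S)) \<partial>uniform01)"
    using SN(4) unfolding sets_\<rho> by (intro emeasure_pair_measure_alt2 vimage)
  also have "\<dots> = (\<integral>\<^sup>+t. 0 \<partial>uniform01)"
  proof (rule nn_integral_cong)
    fix t
    have "(\<lambda>m. (m, t)) -` ((\<lambda>(m, t). m + \<phi> t) -` S) \<subseteq> (\<lambda>x. 0 + x + - \<phi> t) ` U"
    proof
      fix m assume "m \<in> (\<lambda>m. (m, t)) -` ((\<lambda>(m, t). m + \<phi> t) -` S)"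
      then have "m + \<phi> t \<in> U" using SN(1) by auto
      then show "m \<in> (\<lambda>x. 0 + x + - \<phi> t) ` U"
        by (rule rev_image_eqI) (simp add: add.assoc)
    qed
    moreover obtain M where "M \<in> null_sets \<mu>" "(\<lambda>x. 0 + x + - \<phi> t) ` U \<subseteq> M"
      using null[of 0 "- \<phi> t"] unfolding null_sets_completion_iff2 by blast
    ultimately show "emeasure \<mu> ((\<lambda>m. (m, t)) -` ((\<lambda>(m, t). m + \<phi> t) -` S)) = 0"
      by (meson emeasure_eq_0 null_setsD1 null_setsD2 order_trans)
  qed
  finally have "S \<in> null_sets \<rho>"
    using SN(4) by (intro null_setsI) simp_all
  define B where "B = S \<union> N'"
  have B: "B \<in> sets borel" "emeasure \<rho> B = 0" "U \<subseteq> B"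
    using \<open>S \<in> null_sets \<rho>\<close> SN sets_\<rho> null_sets.Un[of S \<rho> N'] by (auto simp: B_def)
  have "(\<integral>\<^sup>+m. emeasure uniform01 (Pair m -` ((\<lambda>(m, t). m + \<phi> t) -` B)) \<partial>\<mu>) =
      emeasure (\<mu> \<Otimes>\<^sub>M uniform01) ((\<lambda>(m, t). m + \<phi> t) -` B)"
    by (intro uniform01.emeasure_pair_measure_alt[symmetric] vimage B(1))
  also have "\<dots> = 0"
    using B(1,2) unfolding \<rho>_def by (simp add: emeasure_distr space)
  finally have "AE m in \<mu>. emeasure uniform01 (Pair m -` ((\<lambda>(m, t). m + \<phi> t) -` B)) = 0"
    by (subst (asm) nn_integral_0_iff_AE) (auto intro!: uniform01.measurable_emeasure_Pair vimage B(1))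
  then obtain m where "emeasure uniform01 (Pair m -` ((\<lambda>(m, t). m + \<phi> t) -` B)) = 0"
    by (rule exE[OF eventually_happens'[OF \<mu>.ae_filter_bot]])
  moreover define Z where "Z = Pair m -` ((\<lambda>(m, t). m + \<phi> t) -` B)"
  moreover have Z: "Z \<in> sets borel"
    unfolding Z_def using sets_Pair1[OF vimage[OF B(1)], of m] by simp
  ultimately have Z0: "emeasure lborel ({0..<1} \<inter> Z) = 0"
    by simp
  define D where "D = {0..<1} - Z"
  have D: "D \<in> sets borel" using Z by (simp add: D_def)
  have "emeasure lborel {0..<1::real} = emeasure lborel ({0..<1} \<inter> Z) + emeasure lborel D"
    unfolding D_def using Z by (subst plus_emeasure) (auto simp: Int_Diff_Un)
  then have D1: "emeasure lborel D = 1"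
    using Z0 by simp
  have "D \<in> sets lebesgue" using D by simp
  then obtain A where A: "closed A" "A \<subseteq> D" "emeasure lebesgue (D - A) < ennreal 1"
    by (rule sets_lebesgue_inner_closed[OF _ zero_less_one])
  have "emeasure lborel D = emeasure lborel A + emeasure lborel (D - A)"
    using plus_emeasure[of A lborel "D - A"] A(1,2) D by (simp add: Un_absorb1)
  moreover have "emeasure lborel (D - A) < 1"
    using A(1,3) D by simp
  ultimately have "emeasure lborel A > 0"
    using D1 by (auto simp: zero_less_iff_neq_zero)
  then obtain a where "a \<in> A" "m + \<phi> a \<in> X"
    using meets[OF A(1)] A(2) unfolding D_def by blast
  then have "a \<in> Z"
    using U(2) B(3) unfolding Z_def by auto
  with \<open>a \<in> A\<close> A(2) show False
    unfolding D_def by blast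
qed

lemma naively_haar_null_if_commutative:
  assumes comm: "\<And>x y :: 'a::topological_group_add. x + y = y + x" and X: "naively_left_haar_null (X :: 'a set)"
  shows "naively_haar_null X"
proof -
  have "(\<lambda>x. g + x + h) ` X = (\<lambda>x. (g + h) + x) ` X" for g h
    by (metis add.assoc comm)
  then show ?thesis
    using X unfolding naively_haar_null_def naively_left_haar_null_def by metis
qed

theorem theorem3p1:
  assumes "uncountable (UNIV :: 'a::{polish_space, topological_group_add} set)"
    and "locally_compact_space (euclidean :: 'a topology)"
  shows "(\<exists>X :: 'a set. naively_left_haar_null X \<and> \<not> haar_null X) \<and>
    ((\<forall>x y :: 'a. x + y = y + x) \<longrightarrow>
      (\<exists>X :: 'a set. naively_haar_null X \<and> \<not> haar_null X))"
proof -
  obtain \<phi> \<psi> :: "real \<Rightarrow> 'a" and K where \<phi>: "\<phi> \<in> borel_measurable borel"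
    and \<psi>: "\<psi> \<in> borel_measurable borel" "closed K" "\<psi> ` {0..<1} \<subseteq> K" "inj_on \<psi> {0..<1}"
    and avoid: "\<And>s t a b c d. s \<in> {0..<1} \<Longrightarrow> t \<in> {0..<1} \<Longrightarrow> s \<noteq> t \<Longrightarrow>
      a \<in> K \<Longrightarrow> b \<in> K \<Longrightarrow> c \<in> K \<Longrightarrow> d \<in> K \<Longrightarrow> - \<phi> s + \<phi> t \<noteq> - a + b - c + d"
    by (rule separated_curves[OF at_zero_neq_bot_if_uncountable[OF assms(1)]]) (rule that)
  obtain X where sparse: "\<And>x y a b. x \<in> X \<Longrightarrow> y \<in> X \<Longrightarrow> x \<noteq> y \<Longrightarrow> a \<in> K \<Longrightarrow> b \<in> K \<Longrightarrow> - x + y \<noteq> - a + b"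
    and meets: "\<And>m A. closed A \<Longrightarrow> A \<subseteq> {0..<1} \<Longrightarrow> emeasure lborel A > 0 \<Longrightarrow> \<exists>a\<in>A. m + \<phi> a \<in> X"
    by (rule exists_sparse_transversal[of K \<phi>], rule avoid, assumption+) (rule that)
  have "naively_left_haar_null X"
    by (rule naively_left_haar_null_if_sparse[OF \<psi> sparse])
  moreover have "\<not> haar_null X"
    by (rule not_haar_null_if_transversal[OF \<phi> meets])
  ultimately show ?thesis
    using naively_haar_null_if_commutative by blast
qed

end
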